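(* Let $\mathbf{B}=(b_{jk})$ be the skew-symmetric matrix $$\mathbf{B}=\begin{pmatrix}0&0&-1&-1&1&1\\0&0&1&1&-1&-1\\1&-1&0&0&-1&1\\1&-1&0&0&1&-1\\-1&1&1&-1&0&0\\-1&1&-1&1&0&0\end{pmatrix}$$ and let $y_1,\dots,y_6$ be positive coordinates with the Poisson bracket $\{y_j,y_k\}=b_{jk}\,y_jy_k$. Define the functions $$\mathbb{k}_1=\sqrt{y_2y_3y_5}+\sqrt{\tfrac{y_2y_5}{y_3}}+\sqrt{\tfrac{y_5}{y_2y_3}}+\tfrac{1}{\sqrt{y_2y_3y_5}},$$ $$\mathbb{k}_2=\sqrt{y_1y_3y_6}+\sqrt{\tfrac{y_1y_3}{y_6}}+\sqrt{\tfrac{y_3}{y_1y_6}}+\tfrac{1}{\sqrt{y_1y_3y_6}},$$ $$\mathbb{k}_3=\sqrt{y_2y_4y_6}+\sqrt{\tfrac{y_2y_6}{y_4}}+\sqrt{\tfrac{y_6}{y_2y_4}}+\tfrac{1}{\sqrt{y_2y_4y_6}},$$ $$\mathbb{k}_{1,2,3}=\sqrt{y_1y_4y_5}+\sqrt{\tfrac{y_1y_4}{y_5}}+\sqrt{\tfrac{y_4}{y_1y_5}}+\tfrac{1}{\sqrt{y_1y_4y_5}},$$ $$\mathbb{k}_{1,2}=\sqrt{y_1y_2y_5y_6}+\sqrt{\tfrac{y_1y_5y_6}{y_2}}+\sqrt{\tfrac{y_1y_5}{y_2y_6}}+\sqrt{\tfrac{y_1y_6}{y_2y_5}}+\sqrt{\tfrac{y_1}{y_2y_5y_6}}+\tfrac{1}{\sqrt{y_1y_2y_5y_6}},$$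 $$\mathbb{k}_{2,3}=\sqrt{y_1y_2y_3y_4}+\sqrt{\tfrac{y_2y_3y_4}{y_1}}+\sqrt{\tfrac{y_2y_3}{y_1y_4}}+\sqrt{\tfrac{y_2y_4}{y_1y_3}}+\sqrt{\tfrac{y_2}{y_1y_3y_4}}+\tfrac{1}{\sqrt{y_1y_2y_3y_4}},$$ $$\mathbb{b}_1=\sqrt{y_3y_4y_5y_6}+\tfrac{1}{\sqrt{y_3y_4y_5y_6}},\qquad \mathbb{b}_2=y_1y_2\sqrt{y_3y_4y_5y_6}+\tfrac{1}{y_1y_2\sqrt{y_3y_4y_5y_6}}.$$ Then these functions satisfy the relations of the classical skein algebra of the twice-punctured torus $\Sigma_{1,2}$, namely: (a) $\mathrm{Rel}^{cl}(\mathbb{k}_1,\mathbb{k}_2,\mathbb{k}_{1,2})$, $\mathrm{Rel}^{cl}(\mathbb{k}_{1,2},\mathbb{k}_3,\mathbb{k}_{1,2,3})$, $\mathrm{Rel}^{cl}(\mathbb{k}_2,\mathbb{k}_3,\mathbb{k}_{2,3})$, $\mathrm{Rel}^{cl}(\mathbb{k}_1,\mathbb{k}_{2,3},\mathbb{k}_{1,2,3})$, where $\mathrm{Rel}^{cl}(\mathbb{x}_0,\mathbb{x}_1,\mathbb{x}_2)$ means $\{\mathbb{x}_i,\mathbb{x}_{i+1}\}=\tfrac12\mathbb{x}_i\mathbb{x}_{i+1}-\mathbb{x}_{i+2}$ for all $i\in\mathbb{Z}/3$; (b) $\{\mathbb{k}_1,\mathbb{k}_3\}=0$, $\{\mathbb{k}_2,\mathbb{k}_{1,2,3}\}=0$,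 $\{\mathbb{k}_{1,2},\mathbb{k}_{2,3}\}=\mathbb{k}_1\mathbb{k}_3-\mathbb{k}_2\mathbb{k}_{1,2,3}$, and $\mathbb{b}_1,\mathbb{b}_2$ Poisson-commute with all the functions listed; (c) $\mathbb{k}_{1,2}\mathbb{k}_{2,3}=\mathbb{k}_1\mathbb{k}_3+\mathbb{k}_2\mathbb{k}_{1,2,3}+\mathbb{b}_1+\mathbb{b}_2$; (d) $\mathbb{k}_1\mathbb{k}_2\mathbb{k}_3\mathbb{k}_{1,2,3}+\mathbb{k}_1^2+\mathbb{k}_2^2+\mathbb{k}_3^2+\mathbb{k}_{1,2}^2+\mathbb{k}_{2,3}^2+\mathbb{k}_{1,2,3}^2=(\mathbb{k}_1\mathbb{k}_2+\mathbb{k}_3\mathbb{k}_{1,2,3})\,\mathbb{k}_{1,2}+(\mathbb{k}_2\mathbb{k}_3+\mathbb{k}_1\mathbb{k}_{1,2,3})\,\mathbb{k}_{2,3}+\mathbb{b}_1\mathbb{b}_2+4$.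
   Context: The Poisson bracket is extended to functions of $y_1,\dots,y_6$ (in particular Laurent polynomials in $\sqrt{y_1},\dots,\sqrt{y_6}$) by bilinearity, skew-symmetry and the Leibniz rule, i.e. $\{f,g\}=\sum_{j,k}b_{jk}\,y_jy_k\,\frac{\partial f}{\partial y_j}\frac{\partial g}{\partial y_k}$. Square roots are positive square roots of positive variables. The symbols $\mathbb{k}_i,\mathbb{k}_{i,j},\mathbb{k}_{1,2,3}$ correspond to simple closed curves and $\mathbb{b}_1,\mathbb{b}_2$ to the boundary curves of the punctures on $\Sigma_{1,2}$; the matrix $\mathbf{B}$ is the exchange matrix of an ideal triangulation of $\Sigma_{1,2}$. The relations (a)–(d) are the defining relations of the classical skein algebra $\mathrm{Sk}^{cl}(\Sigma_{1,2})$ (the $A\to1$ limit of the Kauffman bracket skein algebra). *)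

theory Defs
  imports "HOL-Analysis.Analysis"
begin

text \<open>
  Coordinates are vectors \<open>y :: real^6\<close>. The index type \<open>6\<close> consists of the residues modulo \<open>6\<close>, so
  the numerals \<open>1\<close> to \<open>6\<close> denote its six distinct elements (and \<open>6 = 0\<close> there).
\<close>

lemma UNIV_6: "(UNIV :: 6 set) = {1, 2, 3, 4, 5, 6}"
proof -
  have "i \<in> {1, 2, 3, 4, 5, 6}" for i :: 6
  proof (induct i)
    case (of_int z)
    then have "0 \<le> z" "z < 6" by simp_all
    then have "z = 0 \<or> z = 1 \<or> z = 2 \<or> z = 3 \<or> z = 4 \<or> z = 5" by arith
    then show ?case by auto
  qed
  then show ?thesis by auto
qed

lemma forall_6: "(\<forall>i::6. P i) \<longleftrightarrow> P 1 \<and> P 2 \<and> P 3 \<and> P 4 \<and> P 5 \<and> P 6"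
  using UNIV_6 by (metis UNIV_I empty_iff insert_iff)

lemma vector_6 [simp]:
  "(vector [a, b, c, d, e, f] :: ('a::zero)^6) $ 1 = a"
  "(vector [a, b, c, d, e, f] :: ('a::zero)^6) $ 2 = b"
  "(vector [a, b, c, d, e, f] :: ('a::zero)^6) $ 3 = c"
  "(vector [a, b, c, d, e, f] :: ('a::zero)^6) $ 4 = d"
  "(vector [a, b, c, d, e, f] :: ('a::zero)^6) $ 5 = e"
  "(vector [a, b, c, d, e, f] :: ('a::zero)^6) $ 6 = f"
  unfolding vector_def by simp_all

definition B :: "real^6^6" where
  "B = vector
    [vector [ 0,  0, -1, -1,  1,  1],
     vector [ 0,  0,  1,  1, -1, -1],
     vector [ 1, -1,  0,  0, -1,  1],
     vector [ 1, -1,  0,  0,  1, -1],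
     vector [-1,  1,  1, -1,  0,  0],
     vector [-1,  1, -1,  1,  0,  0]]"

lemma B_skew: "transpose B = - B"
  unfolding transpose_def B_def by (simp add: vec_eq_iff forall_6)

definition positive_coords :: "(real^6) set" where
  "positive_coords = {y. \<forall>i. y $ i > 0}"

definition pderiv_coord :: "6 \<Rightarrow> (real^6 \<Rightarrow> real) \<Rightarrow> real^6 \<Rightarrow> real" where
  "pderiv_coord j f y = deriv (\<lambda>t. f (y + t *\<^sub>R axis j 1)) 0"

definition poisson :: "(real^6 \<Rightarrow> real) \<Rightarrow> (real^6 \<Rightarrow> real) \<Rightarrow> real^6 \<Rightarrow> real" where
  "poisson f g y =
    (\<Sum>j\<in>UNIV. \<Sum>k\<in>UNIV. B $ j $ k * y $ j * y $ k * pderiv_coord j f y * pderiv_coord k g y)"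

lemma poisson_coords: "poisson (\<lambda>y. y $ j) (\<lambda>y. y $ k) y = B $ j $ k * y $ j * y $ k"
proof -
  have pd: "pderiv_coord i (\<lambda>y. y $ l) y = (if i = l then 1 else 0)" for i l
    unfolding pderiv_coord_def
    by (rule DERIV_imp_deriv) (auto simp: axis_def intro!: derivative_eq_intros)
  have "poisson (\<lambda>y. y $ j) (\<lambda>y. y $ k) y =
        (\<Sum>j'\<in>UNIV. \<Sum>k'\<in>UNIV. if k' = k then if j' = j then B $ j' $ k' * y $ j' * y $ k' else 0 else 0)"
    unfolding poisson_def pd by (intro sum.cong refl) simp
  then show ?thesis by simp
qed

definition Rel_cl :: "(real^6 \<Rightarrow> real) \<Rightarrow> (real^6 \<Rightarrow> real) \<Rightarrow> (real^6 \<Rightarrow> real) \<Rightarrow> bool" where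
  "Rel_cl x0 x1 x2 \<longleftrightarrow>
    (\<forall>y\<in>positive_coords.
      poisson x0 x1 y = 1/2 * x0 y * x1 y - x2 y \<and>
      poisson x1 x2 y = 1/2 * x1 y * x2 y - x0 y \<and>
      poisson x2 x0 y = 1/2 * x2 y * x0 y - x1 y)"

definition poisson_commute :: "(real^6 \<Rightarrow> real) \<Rightarrow> (real^6 \<Rightarrow> real) \<Rightarrow> bool" where
  "poisson_commute f g \<longleftrightarrow> (\<forall>y\<in>positive_coords. poisson f g y = 0)"

definition k1 :: "real^6 \<Rightarrow> real" where
  "k1 y = sqrt (y$2 * y$3 * y$5) + sqrt (y$2 * y$5 / y$3) + sqrt (y$5 / (y$2 * y$3))
        + 1 / sqrt (y$2 * y$3 * y$5)"

definition k2 :: "real^6 \<Rightarrow> real" where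
  "k2 y = sqrt (y$1 * y$3 * y$6) + sqrt (y$1 * y$3 / y$6) + sqrt (y$3 / (y$1 * y$6))
        + 1 / sqrt (y$1 * y$3 * y$6)"

definition k3 :: "real^6 \<Rightarrow> real" where
  "k3 y = sqrt (y$2 * y$4 * y$6) + sqrt (y$2 * y$6 / y$4) + sqrt (y$6 / (y$2 * y$4))
        + 1 / sqrt (y$2 * y$4 * y$6)"

definition k123 :: "real^6 \<Rightarrow> real" where
  "k123 y = sqrt (y$1 * y$4 * y$5) + sqrt (y$1 * y$4 / y$5) + sqrt (y$4 / (y$1 * y$5))
        + 1 / sqrt (y$1 * y$4 * y$5)"

definition k12 :: "real^6 \<Rightarrow> real" where
  "k12 y = sqrt (y$1 * y$2 * y$5 * y$6) + sqrt (y$1 * y$5 * y$6 / y$2)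
        + sqrt (y$1 * y$5 / (y$2 * y$6)) + sqrt (y$1 * y$6 / (y$2 * y$5))
        + sqrt (y$1 / (y$2 * y$5 * y$6)) + 1 / sqrt (y$1 * y$2 * y$5 * y$6)"

definition k23 :: "real^6 \<Rightarrow> real" where
  "k23 y = sqrt (y$1 * y$2 * y$3 * y$4) + sqrt (y$2 * y$3 * y$4 / y$1)
        + sqrt (y$2 * y$3 / (y$1 * y$4)) + sqrt (y$2 * y$4 / (y$1 * y$3))
        + sqrt (y$2 / (y$1 * y$3 * y$4)) + 1 / sqrt (y$1 * y$2 * y$3 * y$4)"

definition b1 :: "real^6 \<Rightarrow> real" where
  "b1 y = sqrt (y$3 * y$4 * y$5 * y$6) + 1 / sqrt (y$3 * y$4 * y$5 * y$6)"

definition b2 :: "real^6 \<Rightarrow> real" where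
  "b2 y = y$1 * y$2 * sqrt (y$3 * y$4 * y$5 * y$6)
        + 1 / (y$1 * y$2 * sqrt (y$3 * y$4 * y$5 * y$6))"

end

theory Submission
  imports Defs
begin

text \<open>
  Each of the eight functions is, on the positive orthant, a Laurent polynomial with unit
  coefficients in the square roots \<open>\<surd>y\<^sub>1, \<dots>, \<surd>y\<^sub>6\<close>. The bracket is log-canonical: a Laurent
  monomial \<open>M\<^sub>a = \<Prod>\<^sub>i (\<surd>y\<^sub>i) powi a\<^sub>i\<close> is an eigenvector of every Euler operator
  \<open>y\<^sub>j \<partial>/\<partial>y\<^sub>j\<close>, with eigenvalue \<open>a\<^sub>j / 2\<close>, and therefore
  \<open>{M\<^sub>a, M\<^sub>b} = \<omega>(a, b) / 4 \<cdot> M\<^sub>a\<^sub>+\<^sub>b\<close> for the skew bilinear form \<open>\<omega>\<close> of the exchange matrix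
  (\<open>poisson_laurent\<close> together with \<open>laurent_monomial_mult\<close>). This removes all the analysis: both
  sides of every relation become integer or half-integer combinations of monomials, and the
  relation holds because the coefficients agree monomial by monomial.

  For example, in \<open>Rel_cl\<close> the bracket of two of the functions reproduces half the product on the
  pairs with \<open>\<omega>(a, b) = 2\<close>; the defect from half the product comes only from the pairs with
  \<open>\<omega>(a, b) \<noteq> 2\<close>, and it sums to the third function.

  The puncture functions \<open>b1\<close> and \<open>b2\<close> commute with everything for a reason that needs no
  expansion: their exponent vectors \<open>\<plusminus>(0,0,1,1,1,1)\<close> and \<open>\<plusminus>(2,2,1,1,1,1)\<close> lie in the kernel of
  the exchange matrix, so \<open>\<omega>\<close> vanishes on them (\<open>poisson_commute_of_kernel\<close>).
\<close>

section \<open>Laurent polynomials in the square roots and their brackets\<close>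

text \<open>Exponents are those of \<open>\<surd>y\<^sub>i\<close>, which keeps them integral.\<close>

definition laurent_monomial :: "int^6 \<Rightarrow> real^6 \<Rightarrow> real" where
  "laurent_monomial a y = (\<Prod>i\<in>UNIV. sqrt (y $ i) powi (a $ i))"

definition laurent :: "(int^6) list \<Rightarrow> real^6 \<Rightarrow> real" where
  "laurent as y = (\<Sum>a\<leftarrow>as. laurent_monomial a y)"

definition exchange_form :: "int^6 \<Rightarrow> int^6 \<Rightarrow> real" where
  "exchange_form a b = (\<Sum>j\<in>UNIV. \<Sum>k\<in>UNIV. B $ j $ k * of_int (a $ j) * of_int (b $ k))"

lemma positive_coordsD: "y \<in> positive_coords \<Longrightarrow> y $ i > 0"
  by (simp add: positive_coords_def)

lemma laurent_monomial_mult: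
  assumes "y \<in> positive_coords"
  shows "laurent_monomial a y * laurent_monomial b y = laurent_monomial (a + b) y"
  using positive_coordsD[OF assms]
  by (simp add: laurent_monomial_def prod.distrib[symmetric] power_int_add less_imp_neq[symmetric])

lemma laurent_monomial_mult_left:
  assumes "y \<in> positive_coords"
  shows "laurent_monomial a y * (laurent_monomial b y * c) = laurent_monomial (a + b) y * c"
  using laurent_monomial_mult[OF assms] by (metis mult.assoc)

lemma laurent_monomial_deriv:
  assumes y: "y \<in> positive_coords"
  shows "((\<lambda>t. laurent_monomial a (y + t *\<^sub>R axis j 1))
           has_real_derivative of_int (a $ j) / (2 * y $ j) * laurent_monomial a y) (at 0)"
proof -
  have pos: "y $ j > 0" using y by (rule positive_coordsD)
  define rest where "rest = (\<Prod>i\<in>UNIV - {j}. sqrt (y $ i) powi (a $ i))"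
  have split: "laurent_monomial a (y + t *\<^sub>R axis j 1) = sqrt (y $ j + t) powi (a $ j) * rest" for t
  proof -
    have "(\<Prod>i\<in>UNIV - {j}. sqrt ((y + t *\<^sub>R axis j 1) $ i) powi (a $ i)) = rest"
      unfolding rest_def by (rule prod.cong) (auto simp: axis_def)
    then show ?thesis
      unfolding laurent_monomial_def by (subst prod.remove[of _ j]) (auto simp: axis_def)
  qed
  have at_y: "laurent_monomial a y = sqrt (y $ j) powi (a $ j) * rest"
    using split[of 0] by simp
  have "((\<lambda>t. sqrt (y $ j + t) powi (a $ j)) has_real_derivative
      of_int (a $ j) / (2 * y $ j) * sqrt (y $ j) powi (a $ j)) (at 0)"
    using pos by (auto intro!: derivative_eq_intros simp: power_int_diff field_simps)
  from DERIV_cmult_right[OF this, of rest] show ?thesis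
    unfolding split at_y by (simp add: mult.assoc)
qed

text \<open>
  The representation of \<open>f\<close> as a Laurent polynomial is only assumed on the positive orthant. That
  suffices because the orthant is open, so \<open>f\<close> agrees with the Laurent polynomial near the point
  of differentiation.
\<close>

lemma euler_operator_laurent:
  assumes y: "y \<in> positive_coords" and f: "\<And>y. y \<in> positive_coords \<Longrightarrow> f y = laurent as y"
  shows "y $ j * pderiv_coord j f y = (\<Sum>a\<leftarrow>as. of_int (a $ j) / 2 * laurent_monomial a y)"
proof -
  have pos: "y $ i > 0" for i using y by (rule positive_coordsD)
  have near: "\<forall>\<^sub>F t in nhds 0. f (y + t *\<^sub>R axis j 1) = laurent as (y + t *\<^sub>R axis j 1)"
  proof -
    have "\<forall>\<^sub>F t in nhds (0::real). t \<in> {- (y $ j)<..}"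
      using pos[of j] by (intro eventually_nhds_in_open) auto
    then show ?thesis
    proof eventually_elim
      case (elim t)
      then show ?case
        using pos by (intro f) (auto simp: positive_coords_def axis_def)
    qed
  qed
  have "((\<lambda>t. laurent as (y + t *\<^sub>R axis j 1)) has_real_derivative
      (\<Sum>a\<leftarrow>as. of_int (a $ j) / (2 * y $ j) * laurent_monomial a y)) (at 0)"
    unfolding laurent_def
  proof (induction as)
    case (Cons a as)
    then show ?case
      using DERIV_add[OF laurent_monomial_deriv[OF y]] by simp
  qed simp
  then have "pderiv_coord j f y = (\<Sum>a\<leftarrow>as. of_int (a $ j) / (2 * y $ j) * laurent_monomial a y)"
    unfolding pderiv_coord_def using DERIV_cong_ev[OF refl near refl] by (intro DERIV_imp_deriv) blast
  then show ?thesis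
    using pos[of j] by (simp add: sum_list_const_mult[symmetric] algebra_simps)
qed

lemma sum_sum_list_swap:
  "(\<Sum>j\<in>A. \<Sum>a\<leftarrow>as. h j a) = (\<Sum>a\<leftarrow>as. \<Sum>j\<in>A. h j a :: 'a::comm_monoid_add)"
  by (induction as) (simp_all add: sum.distrib)

lemma sum_list_product:
  "c * (\<Sum>a\<leftarrow>as. f a) * (\<Sum>b\<leftarrow>bs. g b) = (\<Sum>a\<leftarrow>as. \<Sum>b\<leftarrow>bs. c * f a * g b :: 'a::semiring_0)"
  by (simp add: sum_list_const_mult sum_list_mult_const)

text \<open>
  Regrouping the weights \<open>y\<^sub>j y\<^sub>k\<close> of the bracket with the partial derivatives turns it into a
  bilinear expression in Euler operators, which act diagonally on monomials. The factor \<open>1/4\<close>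
  comes from the two eigenvalues \<open>a\<^sub>j / 2\<close> and \<open>b\<^sub>k / 2\<close>.
\<close>

lemma poisson_laurent:
  assumes y: "y \<in> positive_coords"
    and f: "\<And>y. y \<in> positive_coords \<Longrightarrow> f y = laurent as y"
    and g: "\<And>y. y \<in> positive_coords \<Longrightarrow> g y = laurent bs y"
  shows "poisson f g y =
    (\<Sum>a\<leftarrow>as. \<Sum>b\<leftarrow>bs. exchange_form a b / 4 * laurent_monomial a y * laurent_monomial b y)"
proof -
  let ?m = "\<lambda>a. laurent_monomial a y"
  have euler_f: "y $ j * pderiv_coord j f y = (\<Sum>a\<leftarrow>as. of_int (a $ j) / 2 * ?m a)" for j
    using y f by (rule euler_operator_laurent)
  have euler_g: "y $ k * pderiv_coord k g y = (\<Sum>b\<leftarrow>bs. of_int (b $ k) / 2 * ?m b)" for k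
    using y g by (rule euler_operator_laurent)
  have "poisson f g y =
    (\<Sum>j\<in>UNIV. \<Sum>k\<in>UNIV. B $ j $ k * (y $ j * pderiv_coord j f y) * (y $ k * pderiv_coord k g y))"
    unfolding poisson_def by (simp add: mult_ac)
  also have "\<dots> = (\<Sum>j\<in>UNIV. \<Sum>k\<in>UNIV. \<Sum>a\<leftarrow>as. \<Sum>b\<leftarrow>bs.
      B $ j $ k * (of_int (a $ j) / 2 * ?m a) * (of_int (b $ k) / 2 * ?m b))"
    by (simp only: euler_f euler_g sum_list_product)
  also have "\<dots> = (\<Sum>a\<leftarrow>as. \<Sum>b\<leftarrow>bs. \<Sum>j\<in>UNIV. \<Sum>k\<in>UNIV.
      B $ j $ k * (of_int (a $ j) / 2 * ?m a) * (of_int (b $ k) / 2 * ?m b))"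
    by (simp only: sum_sum_list_swap)
  also have "\<dots> = (\<Sum>a\<leftarrow>as. \<Sum>b\<leftarrow>bs. exchange_form a b / 4 * ?m a * ?m b)"
    by (simp add: exchange_form_def sum_divide_distrib sum_distrib_left sum_distrib_right mult_ac)
  finally show ?thesis .
qed

lemma poisson_commute_of_kernel:
  assumes f: "\<And>y. y \<in> positive_coords \<Longrightarrow> f y = laurent as y"
    and g: "\<And>y. y \<in> positive_coords \<Longrightarrow> g y = laurent bs y"
    and kernel: "\<And>a b. a \<in> set as \<Longrightarrow> exchange_form a b = 0"
  shows "poisson_commute f g"
proof -
  have "(\<Sum>a\<leftarrow>as. \<Sum>b\<leftarrow>bs. exchange_form a b / 4 * laurent_monomial a y * laurent_monomial b y)
      = (\<Sum>a\<leftarrow>as. 0)" for y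
    by (intro arg_cong[of _ _ sum_list] map_cong) (simp_all add: kernel)
  then show ?thesis
    unfolding poisson_commute_def by (simp add: poisson_laurent[OF _ f g])
qed

section \<open>Calculating with explicit exponent vectors\<close>

lemma sum_6: "sum h (UNIV :: 6 set) = h 1 + h 2 + h 3 + h 4 + h 5 + h 6"
  unfolding UNIV_6 by (simp add: add.assoc)

lemma prod_6: "prod h (UNIV :: 6 set) = h 1 * h 2 * h 3 * h 4 * h 5 * h 6"
  unfolding UNIV_6 by (simp add: mult.assoc)

text \<open>
  The coordinates of each exponent vector enter the form only through the differences
  \<open>a\<^sub>1 - a\<^sub>2\<close>, \<open>a\<^sub>3 - a\<^sub>4\<close>, \<open>a\<^sub>5 - a\<^sub>6\<close> and the combination \<open>a\<^sub>3 + a\<^sub>4 - a\<^sub>5 - a\<^sub>6\<close>. All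
  four vanish on the exponent vectors of the puncture functions.
\<close>

lemma exchange_form_expand:
  "exchange_form a b =
    of_int ((a$1 - a$2) * (b$5 + b$6 - b$3 - b$4) + (a$3 + a$4 - a$5 - a$6) * (b$1 - b$2)
      + (a$3 - a$4) * (b$6 - b$5) + (a$5 - a$6) * (b$3 - b$4))"
  unfolding exchange_form_def B_def sum_6 by (simp add: algebra_simps)

lemma laurent_monomial_expand:
  "laurent_monomial a y = sqrt (y$1) powi (a$1) * sqrt (y$2) powi (a$2) * sqrt (y$3) powi (a$3)
    * sqrt (y$4) powi (a$4) * sqrt (y$5) powi (a$5) * sqrt (y$6) powi (a$6)"
  unfolding laurent_monomial_def by (rule prod_6)

lemma laurent_monomial_zero: "laurent_monomial (vector [0, 0, 0, 0, 0, 0]) y = 1"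
  by (simp add: laurent_monomial_expand)

lemma vector_6_add: "(vector [a, b, c, d, e, f] :: int^6) + vector [a', b', c', d', e', f']
    = vector [a + a', b + b', c + c', d + d', e + e', f + f']"
  by (simp add: vec_eq_iff forall_6)

section \<open>Exponents of the curve and puncture functions\<close>

definition k1_exps :: "(int^6) list" where
  "k1_exps =
    [vector [0, 1, 1, 0, 1, 0],
     vector [0, 1, -1, 0, 1, 0],
     vector [0, -1, -1, 0, 1, 0],
     vector [0, -1, -1, 0, -1, 0]]"

definition k2_exps :: "(int^6) list" where
  "k2_exps =
    [vector [1, 0, 1, 0, 0, 1],
     vector [1, 0, 1, 0, 0, -1],
     vector [-1, 0, 1, 0, 0, -1],
     vector [-1, 0, -1, 0, 0, -1]]"

definition k3_exps :: "(int^6) list" where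
  "k3_exps =
    [vector [0, 1, 0, 1, 0, 1],
     vector [0, 1, 0, -1, 0, 1],
     vector [0, -1, 0, -1, 0, 1],
     vector [0, -1, 0, -1, 0, -1]]"

definition k123_exps :: "(int^6) list" where
  "k123_exps =
    [vector [1, 0, 0, 1, 1, 0],
     vector [1, 0, 0, 1, -1, 0],
     vector [-1, 0, 0, 1, -1, 0],
     vector [-1, 0, 0, -1, -1, 0]]"

definition k12_exps :: "(int^6) list" where
  "k12_exps =
    [vector [1, 1, 0, 0, 1, 1],
     vector [1, -1, 0, 0, 1, 1],
     vector [1, -1, 0, 0, 1, -1],
     vector [1, -1, 0, 0, -1, 1],
     vector [1, -1, 0, 0, -1, -1],
     vector [-1, -1, 0, 0, -1, -1]]"

definition k23_exps :: "(int^6) list" where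
  "k23_exps =
    [vector [1, 1, 1, 1, 0, 0],
     vector [-1, 1, 1, 1, 0, 0],
     vector [-1, 1, 1, -1, 0, 0],
     vector [-1, 1, -1, 1, 0, 0],
     vector [-1, 1, -1, -1, 0, 0],
     vector [-1, -1, -1, -1, 0, 0]]"

definition b1_exps :: "(int^6) list" where
  "b1_exps =
    [vector [0, 0, 1, 1, 1, 1],
     vector [0, 0, -1, -1, -1, -1]]"

definition b2_exps :: "(int^6) list" where
  "b2_exps =
    [vector [2, 2, 1, 1, 1, 1],
     vector [-2, -2, -1, -1, -1, -1]]"

lemma k1_laurent: "y \<in> positive_coords \<Longrightarrow> k1 y = laurent k1_exps y"
  using positive_coordsD[of y 1] positive_coordsD[of y 2] positive_coordsD[of y 3]
    positive_coordsD[of y 4] positive_coordsD[of y 5] positive_coordsD[of y 6]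
  by (simp add: k1_def k1_exps_def laurent_def laurent_monomial_expand real_sqrt_mult
      real_sqrt_divide power_int_minus field_simps)

lemma k2_laurent: "y \<in> positive_coords \<Longrightarrow> k2 y = laurent k2_exps y"
  using positive_coordsD[of y 1] positive_coordsD[of y 2] positive_coordsD[of y 3]
    positive_coordsD[of y 4] positive_coordsD[of y 5] positive_coordsD[of y 6]
  by (simp add: k2_def k2_exps_def laurent_def laurent_monomial_expand real_sqrt_mult
      real_sqrt_divide power_int_minus field_simps)

lemma k3_laurent: "y \<in> positive_coords \<Longrightarrow> k3 y = laurent k3_exps y"
  using positive_coordsD[of y 1] positive_coordsD[of y 2] positive_coordsD[of y 3]
    positive_coordsD[of y 4] positive_coordsD[of y 5] positive_coordsD[of y 6]
  by (simp add: k3_def k3_exps_def laurent_def laurent_monomial_expand real_sqrt_mult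
      real_sqrt_divide power_int_minus field_simps)

lemma k123_laurent: "y \<in> positive_coords \<Longrightarrow> k123 y = laurent k123_exps y"
  using positive_coordsD[of y 1] positive_coordsD[of y 2] positive_coordsD[of y 3]
    positive_coordsD[of y 4] positive_coordsD[of y 5] positive_coordsD[of y 6]
  by (simp add: k123_def k123_exps_def laurent_def laurent_monomial_expand real_sqrt_mult
      real_sqrt_divide power_int_minus field_simps)

lemma k12_laurent: "y \<in> positive_coords \<Longrightarrow> k12 y = laurent k12_exps y"
  using positive_coordsD[of y 1] positive_coordsD[of y 2] positive_coordsD[of y 3]
    positive_coordsD[of y 4] positive_coordsD[of y 5] positive_coordsD[of y 6]
  by (simp add: k12_def k12_exps_def laurent_def laurent_monomial_expand real_sqrt_mult
      real_sqrt_divide power_int_minus field_simps)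

lemma k23_laurent: "y \<in> positive_coords \<Longrightarrow> k23 y = laurent k23_exps y"
  using positive_coordsD[of y 1] positive_coordsD[of y 2] positive_coordsD[of y 3]
    positive_coordsD[of y 4] positive_coordsD[of y 5] positive_coordsD[of y 6]
  by (simp add: k23_def k23_exps_def laurent_def laurent_monomial_expand real_sqrt_mult
      real_sqrt_divide power_int_minus field_simps)

lemma b1_laurent: "y \<in> positive_coords \<Longrightarrow> b1 y = laurent b1_exps y"
  using positive_coordsD[of y 1] positive_coordsD[of y 2] positive_coordsD[of y 3]
    positive_coordsD[of y 4] positive_coordsD[of y 5] positive_coordsD[of y 6]
  by (simp add: b1_def b1_exps_def laurent_def laurent_monomial_expand real_sqrt_mult
      real_sqrt_divide power_int_minus field_simps)

lemma b2_laurent: "y \<in> positive_coords \<Longrightarrow> b2 y = laurent b2_exps y"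
  using positive_coordsD[of y 1] positive_coordsD[of y 2] positive_coordsD[of y 3]
    positive_coordsD[of y 4] positive_coordsD[of y 5] positive_coordsD[of y 6]
  by (simp add: b2_def b2_exps_def laurent_def laurent_monomial_expand real_sqrt_mult
      real_sqrt_divide power_int_minus field_simps)

lemmas laurent_forms =
  k1_laurent k2_laurent k3_laurent k123_laurent k12_laurent k23_laurent b1_laurent b2_laurent

lemmas exps_defs =
  k1_exps_def k2_exps_def k3_exps_def k123_exps_def k12_exps_def k23_exps_def b1_exps_def b2_exps_def

text \<open>
  Rewriting with these rules brings a polynomial expression in Laurent monomials into the normal
  form of a linear combination of monomials with explicit exponents. The skein relations hold
  coefficientwise, so they need no further fact about the monomials, which act as unknowns.
\<close>

lemmas monomial_normal_form =
  algebra_simps laurent_monomial_mult laurent_monomial_mult_left laurent_monomial_zero vector_6_add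

lemma exchange_form_b1_exps: "a \<in> set b1_exps \<Longrightarrow> exchange_form a b = 0"
  by (auto simp: b1_exps_def exchange_form_expand)

lemma exchange_form_b2_exps: "a \<in> set b2_exps \<Longrightarrow> exchange_form a b = 0"
  by (auto simp: b2_exps_def exchange_form_expand)

section \<open>The skein relations\<close>

lemma poisson_k1_k2:
  assumes "y \<in> positive_coords"
  shows "poisson k1 k2 y = 1/2 * k1 y * k2 y - k12 y"
proof -
  have "poisson k1 k2 y = (\<Sum>a\<leftarrow>k1_exps. \<Sum>b\<leftarrow>k2_exps.
      exchange_form a b / 4 * laurent_monomial a y * laurent_monomial b y)"
    using assms k1_laurent k2_laurent by (rule poisson_laurent)
  also have "\<dots> = 1/2 * k1 y * k2 y - k12 y"
    using assms
    by (simp add: laurent_forms exps_defs laurent_def exchange_form_expand monomial_normal_form)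
  finally show ?thesis .
qed

lemma poisson_k2_k12:
  assumes "y \<in> positive_coords"
  shows "poisson k2 k12 y = 1/2 * k2 y * k12 y - k1 y"
proof -
  have "poisson k2 k12 y = (\<Sum>a\<leftarrow>k2_exps. \<Sum>b\<leftarrow>k12_exps.
      exchange_form a b / 4 * laurent_monomial a y * laurent_monomial b y)"
    using assms k2_laurent k12_laurent by (rule poisson_laurent)
  also have "\<dots> = 1/2 * k2 y * k12 y - k1 y"
    using assms
    by (simp add: laurent_forms exps_defs laurent_def exchange_form_expand monomial_normal_form)
  finally show ?thesis .
qed

lemma poisson_k12_k1:
  assumes "y \<in> positive_coords"
  shows "poisson k12 k1 y = 1/2 * k12 y * k1 y - k2 y"
proof -
  have "poisson k12 k1 y = (\<Sum>a\<leftarrow>k12_exps. \<Sum>b\<leftarrow>k1_exps.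
      exchange_form a b / 4 * laurent_monomial a y * laurent_monomial b y)"
    using assms k12_laurent k1_laurent by (rule poisson_laurent)
  also have "\<dots> = 1/2 * k12 y * k1 y - k2 y"
    using assms
    by (simp add: laurent_forms exps_defs laurent_def exchange_form_expand monomial_normal_form)
  finally show ?thesis .
qed

lemma poisson_k12_k3:
  assumes "y \<in> positive_coords"
  shows "poisson k12 k3 y = 1/2 * k12 y * k3 y - k123 y"
proof -
  have "poisson k12 k3 y = (\<Sum>a\<leftarrow>k12_exps. \<Sum>b\<leftarrow>k3_exps.
      exchange_form a b / 4 * laurent_monomial a y * laurent_monomial b y)"
    using assms k12_laurent k3_laurent by (rule poisson_laurent)
  also have "\<dots> = 1/2 * k12 y * k3 y - k123 y"
    using assms
    by (simp add: laurent_forms exps_defs laurent_def exchange_form_expand monomial_normal_form)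
  finally show ?thesis .
qed

lemma poisson_k3_k123:
  assumes "y \<in> positive_coords"
  shows "poisson k3 k123 y = 1/2 * k3 y * k123 y - k12 y"
proof -
  have "poisson k3 k123 y = (\<Sum>a\<leftarrow>k3_exps. \<Sum>b\<leftarrow>k123_exps.
      exchange_form a b / 4 * laurent_monomial a y * laurent_monomial b y)"
    using assms k3_laurent k123_laurent by (rule poisson_laurent)
  also have "\<dots> = 1/2 * k3 y * k123 y - k12 y"
    using assms
    by (simp add: laurent_forms exps_defs laurent_def exchange_form_expand monomial_normal_form)
  finally show ?thesis .
qed

lemma poisson_k123_k12:
  assumes "y \<in> positive_coords"
  shows "poisson k123 k12 y = 1/2 * k123 y * k12 y - k3 y"
proof -
  have "poisson k123 k12 y = (\<Sum>a\<leftarrow>k123_exps. \<Sum>b\<leftarrow>k12_exps.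
      exchange_form a b / 4 * laurent_monomial a y * laurent_monomial b y)"
    using assms k123_laurent k12_laurent by (rule poisson_laurent)
  also have "\<dots> = 1/2 * k123 y * k12 y - k3 y"
    using assms
    by (simp add: laurent_forms exps_defs laurent_def exchange_form_expand monomial_normal_form)
  finally show ?thesis .
qed

lemma poisson_k2_k3:
  assumes "y \<in> positive_coords"
  shows "poisson k2 k3 y = 1/2 * k2 y * k3 y - k23 y"
proof -
  have "poisson k2 k3 y = (\<Sum>a\<leftarrow>k2_exps. \<Sum>b\<leftarrow>k3_exps.
      exchange_form a b / 4 * laurent_monomial a y * laurent_monomial b y)"
    using assms k2_laurent k3_laurent by (rule poisson_laurent)
  also have "\<dots> = 1/2 * k2 y * k3 y - k23 y"
    using assms
    by (simp add: laurent_forms exps_defs laurent_def exchange_form_expand monomial_normal_form)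
  finally show ?thesis .
qed

lemma poisson_k3_k23:
  assumes "y \<in> positive_coords"
  shows "poisson k3 k23 y = 1/2 * k3 y * k23 y - k2 y"
proof -
  have "poisson k3 k23 y = (\<Sum>a\<leftarrow>k3_exps. \<Sum>b\<leftarrow>k23_exps.
      exchange_form a b / 4 * laurent_monomial a y * laurent_monomial b y)"
    using assms k3_laurent k23_laurent by (rule poisson_laurent)
  also have "\<dots> = 1/2 * k3 y * k23 y - k2 y"
    using assms
    by (simp add: laurent_forms exps_defs laurent_def exchange_form_expand monomial_normal_form)
  finally show ?thesis .
qed

lemma poisson_k23_k2:
  assumes "y \<in> positive_coords"
  shows "poisson k23 k2 y = 1/2 * k23 y * k2 y - k3 y"
proof -
  have "poisson k23 k2 y = (\<Sum>a\<leftarrow>k23_exps. \<Sum>b\<leftarrow>k2_exps.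
      exchange_form a b / 4 * laurent_monomial a y * laurent_monomial b y)"
    using assms k23_laurent k2_laurent by (rule poisson_laurent)
  also have "\<dots> = 1/2 * k23 y * k2 y - k3 y"
    using assms
    by (simp add: laurent_forms exps_defs laurent_def exchange_form_expand monomial_normal_form)
  finally show ?thesis .
qed

lemma poisson_k1_k23:
  assumes "y \<in> positive_coords"
  shows "poisson k1 k23 y = 1/2 * k1 y * k23 y - k123 y"
proof -
  have "poisson k1 k23 y = (\<Sum>a\<leftarrow>k1_exps. \<Sum>b\<leftarrow>k23_exps.
      exchange_form a b / 4 * laurent_monomial a y * laurent_monomial b y)"
    using assms k1_laurent k23_laurent by (rule poisson_laurent)
  also have "\<dots> = 1/2 * k1 y * k23 y - k123 y"
    using assms
    by (simp add: laurent_forms exps_defs laurent_def exchange_form_expand monomial_normal_form)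
  finally show ?thesis .
qed

lemma poisson_k23_k123:
  assumes "y \<in> positive_coords"
  shows "poisson k23 k123 y = 1/2 * k23 y * k123 y - k1 y"
proof -
  have "poisson k23 k123 y = (\<Sum>a\<leftarrow>k23_exps. \<Sum>b\<leftarrow>k123_exps.
      exchange_form a b / 4 * laurent_monomial a y * laurent_monomial b y)"
    using assms k23_laurent k123_laurent by (rule poisson_laurent)
  also have "\<dots> = 1/2 * k23 y * k123 y - k1 y"
    using assms
    by (simp add: laurent_forms exps_defs laurent_def exchange_form_expand monomial_normal_form)
  finally show ?thesis .
qed

lemma poisson_k123_k1:
  assumes "y \<in> positive_coords"
  shows "poisson k123 k1 y = 1/2 * k123 y * k1 y - k23 y"
proof -
  have "poisson k123 k1 y = (\<Sum>a\<leftarrow>k123_exps. \<Sum>b\<leftarrow>k1_exps.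
      exchange_form a b / 4 * laurent_monomial a y * laurent_monomial b y)"
    using assms k123_laurent k1_laurent by (rule poisson_laurent)
  also have "\<dots> = 1/2 * k123 y * k1 y - k23 y"
    using assms
    by (simp add: laurent_forms exps_defs laurent_def exchange_form_expand monomial_normal_form)
  finally show ?thesis .
qed

lemma poisson_k1_k3:
  assumes "y \<in> positive_coords"
  shows "poisson k1 k3 y = 0"
proof -
  have "poisson k1 k3 y = (\<Sum>a\<leftarrow>k1_exps. \<Sum>b\<leftarrow>k3_exps.
      exchange_form a b / 4 * laurent_monomial a y * laurent_monomial b y)"
    using assms k1_laurent k3_laurent by (rule poisson_laurent)
  also have "\<dots> = 0"
    using assms
    by (simp add: laurent_forms exps_defs laurent_def exchange_form_expand monomial_normal_form)
  finally show ?thesis .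
qed

lemma poisson_k2_k123:
  assumes "y \<in> positive_coords"
  shows "poisson k2 k123 y = 0"
proof -
  have "poisson k2 k123 y = (\<Sum>a\<leftarrow>k2_exps. \<Sum>b\<leftarrow>k123_exps.
      exchange_form a b / 4 * laurent_monomial a y * laurent_monomial b y)"
    using assms k2_laurent k123_laurent by (rule poisson_laurent)
  also have "\<dots> = 0"
    using assms
    by (simp add: laurent_forms exps_defs laurent_def exchange_form_expand monomial_normal_form)
  finally show ?thesis .
qed

lemma poisson_k12_k23:
  assumes "y \<in> positive_coords"
  shows "poisson k12 k23 y = k1 y * k3 y - k2 y * k123 y"
proof -
  have "poisson k12 k23 y = (\<Sum>a\<leftarrow>k12_exps. \<Sum>b\<leftarrow>k23_exps.
      exchange_form a b / 4 * laurent_monomial a y * laurent_monomial b y)"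
    using assms k12_laurent k23_laurent by (rule poisson_laurent)
  also have "\<dots> = k1 y * k3 y - k2 y * k123 y"
    using assms
    by (simp add: laurent_forms exps_defs laurent_def exchange_form_expand monomial_normal_form)
  finally show ?thesis .
qed

lemma product_k12_k23:
  assumes "y \<in> positive_coords"
  shows "k12 y * k23 y = k1 y * k3 y + k2 y * k123 y + b1 y + b2 y"
  using assms by (simp add: laurent_forms exps_defs laurent_def monomial_normal_form)

lemma quartic_relation:
  assumes "y \<in> positive_coords"
  shows "k1 y * k2 y * k3 y * k123 y
        + (k1 y)\<^sup>2 + (k2 y)\<^sup>2 + (k3 y)\<^sup>2 + (k12 y)\<^sup>2 + (k23 y)\<^sup>2 + (k123 y)\<^sup>2
        = (k1 y * k2 y + k3 y * k123 y) * k12 y + (k2 y * k3 y + k1 y * k123 y) * k23 y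
          + b1 y * b2 y + 4"
  using assms
  by (simp add: laurent_forms exps_defs laurent_def power2_eq_square monomial_normal_form)

theorem mainTheorem2:
  shows
    "(Rel_cl k1 k2 k12 \<and> Rel_cl k12 k3 k123 \<and> Rel_cl k2 k3 k23 \<and> Rel_cl k1 k23 k123) \<and>
     (poisson_commute k1 k3 \<and> poisson_commute k2 k123 \<and>
      (\<forall>y\<in>positive_coords. poisson k12 k23 y = k1 y * k3 y - k2 y * k123 y) \<and>
      (\<forall>b\<in>{b1, b2}. \<forall>f\<in>{k1, k2, k3, k12, k23, k123, b1, b2}. poisson_commute b f)) \<and>
     (\<forall>y\<in>positive_coords. k12 y * k23 y = k1 y * k3 y + k2 y * k123 y + b1 y + b2 y) \<and>
     (\<forall>y\<in>positive_coords.
        k1 y * k2 y * k3 y * k123 y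
        + (k1 y)\<^sup>2 + (k2 y)\<^sup>2 + (k3 y)\<^sup>2 + (k12 y)\<^sup>2 + (k23 y)\<^sup>2 + (k123 y)\<^sup>2
        = (k1 y * k2 y + k3 y * k123 y) * k12 y + (k2 y * k3 y + k1 y * k123 y) * k23 y
          + b1 y * b2 y + 4)"
proof (intro conjI)
  show "Rel_cl k1 k2 k12"
    unfolding Rel_cl_def by (simp add: poisson_k1_k2 poisson_k2_k12 poisson_k12_k1)
  show "Rel_cl k12 k3 k123"
    unfolding Rel_cl_def by (simp add: poisson_k12_k3 poisson_k3_k123 poisson_k123_k12)
  show "Rel_cl k2 k3 k23"
    unfolding Rel_cl_def by (simp add: poisson_k2_k3 poisson_k3_k23 poisson_k23_k2)
  show "Rel_cl k1 k23 k123"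
    unfolding Rel_cl_def by (simp add: poisson_k1_k23 poisson_k23_k123 poisson_k123_k1)
  show "poisson_commute k1 k3" "poisson_commute k2 k123"
    unfolding poisson_commute_def by (simp_all add: poisson_k1_k3 poisson_k2_k123)
  show "\<forall>y\<in>positive_coords. poisson k12 k23 y = k1 y * k3 y - k2 y * k123 y"
    by (simp add: poisson_k12_k23)
  have "poisson_commute b1 f" "poisson_commute b2 f" if f: "f \<in> {k1, k2, k3, k12, k23, k123, b1, b2}" for f
  proof -
    obtain as where "\<And>y. y \<in> positive_coords \<Longrightarrow> f y = laurent as y"
      using f laurent_forms by blast
    then show "poisson_commute b1 f" "poisson_commute b2 f"
      using poisson_commute_of_kernel[OF b1_laurent _ exchange_form_b1_exps]
        poisson_commute_of_kernel[OF b2_laurent _ exchange_form_b2_exps] by blast+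
  qed
  then show "\<forall>b\<in>{b1, b2}. \<forall>f\<in>{k1, k2, k3, k12, k23, k123, b1, b2}. poisson_commute b f"
    by blast
qed (use product_k12_k23 quartic_relation in blast)+

end
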